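(* Let $0\le\lambda<1$, $c>-1$ with $-\lambda\le c$, $0<\eta\le1$, and let $\sigma$ be real. If $f\in A$ and $\frac{z(L_cI^\sigma f(z))'}{L_cI^\sigma f(z)}\ne\lambda$ for all $z\in U$, then $f\in ST_\sigma(\eta,\lambda)$ implies $I^\sigma f\in ST_c(\eta,\lambda)$.
   Context: $U=\{z\in\mathbb{C}:|z|<1\}$. $A$ is the class of functions $f(z)=z+\sum_{n=2}^\infty a_nz^n$ analytic in $U$. Quotients such as $zf'(z)/f(z)$ are understood with the removable singularity at $z=0$ filled in; $\arg$ is the principal argument. For $0\le\lambda<1$ and $0<\eta\le1$, $S^*(\eta,\lambda)$ (strongly starlike functions of order $\eta$ and type $\lambda$) is the set of $f\in A$ with $\left|\arg\left(\frac{zf'(z)}{f(z)}-\lambda\right)\right|<\frac{\pi}{2}\eta$ for all $z\in U$. For $c>-1$ and $f\in A$, the generalized Bernardi-Libera-Livingston operator is $L_cf(z)=\frac{c+1}{z^c}\int_0^z t^{c-1}f(t)\,dt$; equivalently $L_cf(z)=z+\sum_{n=2}^\infty\frac{c+1}{n+c}a_nz^n$. For $\sigma>0$ and $f\in A$, $I^\sigma f(z)=\frac{2^\sigma}{z\Gamma(\sigma)}\int_0^z\left(\log\frac{z}{t}\right)^{\sigma-1}f(t)\,dt$; equivalently $I^\sigma f(z)=z+\sum_{n=2}^\infty\left(\frac{2}{n+1}\right)^\sigma a_nz^n$, and this series defines $I^\sigma$ for every real $\sigma$. A subscript $c$ refers to $L_c$ and a subscript $\sigma$ refers to $I^\sigma$: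 $ST_c(\eta,\lambda)=\left\{f\in A: L_cf\in S^*(\eta,\lambda),\ \frac{z(L_cf(z))'}{L_cf(z)}\ne\lambda \text{ for } z\in U\right\}$ and $ST_\sigma(\eta,\lambda)=\left\{f\in A: I^\sigma f\in S^*(\eta,\lambda),\ \frac{z(I^\sigma f(z))'}{I^\sigma f(z)}\ne\lambda \text{ for } z\in U\right\}$. *)

theory Defs
  imports "HOL-Complex_Analysis.Complex_Analysis"
begin

text \<open>
  The class \<open>A\<close>. Only the values on the open unit disc matter: all notions below
  are insensitive to what a function does outside of it.
\<close>
definition class_A :: "(complex \<Rightarrow> complex) set" where
  "class_A = {f. f holomorphic_on ball 0 1 \<and> f 0 = 0 \<and> deriv f 0 = 1}"

text \<open>
  The quotient \<open>z f'(z) / f(z)\<close> with removable singularities filled in; for \<open>f\<close> in \<open>A\<close>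
  this gives the value 1 at 0 (see \<open>starlike_quot_0\<close> below). At a zero of \<open>f\<close> other than 0
  the quotient has a pole and \<^const>\<open>remove_sings\<close> returns a dummy value, so conditions on
  the quotient are always stated together with \<open>quot_finite\<close>.
\<close>
definition starlike_quot :: "(complex \<Rightarrow> complex) \<Rightarrow> complex \<Rightarrow> complex" where
  "starlike_quot f = remove_sings (\<lambda>z. z * deriv f z / f z)"

definition quot_finite :: "(complex \<Rightarrow> complex) \<Rightarrow> complex \<Rightarrow> bool" where
  "quot_finite f z \<longleftrightarrow> z = 0 \<or> f z \<noteq> 0"

text \<open>
  The argument condition presupposes that the quotient is a complex number at every point
  of the disc. The library's convention \<open>Arg 0 = 0\<close> makes no difference here: by the open
  mapping theorem a quotient subject to the condition elsewhere cannot take the value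
  \<open>lam\<close>.
\<close>
definition strongly_starlike :: "real \<Rightarrow> real \<Rightarrow> (complex \<Rightarrow> complex) set" where
  "strongly_starlike \<eta> lam = {f \<in> class_A. \<forall>z\<in>ball 0 1. quot_finite f z \<and>
     \<bar>Arg (starlike_quot f z - of_real lam)\<bar> < pi / 2 * \<eta>}"

text \<open>
  The condition that \<open>z f'(z) / f(z)\<close> is different from \<open>lam\<close> in the disc. A pole of the
  quotient does not count as a violation.
\<close>
definition quot_omits :: "(complex \<Rightarrow> complex) \<Rightarrow> real \<Rightarrow> bool" where
  "quot_omits f lam \<longleftrightarrow>
     (\<forall>z\<in>ball 0 1. quot_finite f z \<longrightarrow> starlike_quot f z \<noteq> of_real lam)"

text \<open>
  The Bernardi-Libera-Livingston operator. The integral is taken along the segment from 0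
  to \<open>z\<close>, on which both powers use the same (principal) branch, so that the result does not
  depend on the branch. At \<open>z = 0\<close> the formula yields 0.
\<close>
definition L_op :: "real \<Rightarrow> (complex \<Rightarrow> complex) \<Rightarrow> complex \<Rightarrow> complex" where
  "L_op c f z = of_real (c + 1) / z powr of_real c *
     contour_integral (linepath 0 z) (\<lambda>t. t powr of_real (c - 1) * f t)"

definition taylor_coeff :: "(complex \<Rightarrow> complex) \<Rightarrow> nat \<Rightarrow> complex" where
  "taylor_coeff f n = (deriv ^^ n) f 0 / fact n"

text \<open>The sum over \<open>n \<ge> 2\<close> is written with \<open>n = k + 2\<close>.\<close>
definition I_op :: "real \<Rightarrow> (complex \<Rightarrow> complex) \<Rightarrow> complex \<Rightarrow> complex" where
  "I_op \<sigma> f z = z + (\<Sum>k. of_real ((2 / (real (k + 2) + 1)) powr \<sigma>) *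
     taylor_coeff f (k + 2) * z ^ (k + 2))"

definition ST_L :: "real \<Rightarrow> real \<Rightarrow> real \<Rightarrow> (complex \<Rightarrow> complex) set" where
  "ST_L c \<eta> lam = {f \<in> class_A. L_op c f \<in> strongly_starlike \<eta> lam \<and> quot_omits (L_op c f) lam}"

definition ST_I :: "real \<Rightarrow> real \<Rightarrow> real \<Rightarrow> (complex \<Rightarrow> complex) set" where
  "ST_I \<sigma> \<eta> lam = {f \<in> class_A. I_op \<sigma> f \<in> strongly_starlike \<eta> lam \<and> quot_omits (I_op \<sigma> f) lam}"


lemma starlike_quot_0:
  assumes "f \<in> class_A"
  shows "starlike_quot f 0 = 1"
proof -
  have hol: "f holomorphic_on ball 0 1" and f0: "f 0 = 0" and f1: "deriv f 0 = 1"
    using assms by (auto simp: class_A_def)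
  have "(f has_field_derivative 1) (at 0)"
    using hol f1 holomorphic_derivI[of f "ball 0 1" 0] by auto
  hence 1: "(\<lambda>z. f z / z) \<midarrow>0\<rightarrow> 1"
    by (simp add: has_field_derivative_iff f0)
  have "isCont (deriv f) 0"
    using hol by (metis analytic_at_imp_isCont analytic_deriv analytic_on_open
        analytic_on_subset centre_in_ball empty_subsetI insert_subset open_ball zero_less_one)
  hence 2: "deriv f \<midarrow>0\<rightarrow> 1"
    using f1 by (simp add: isCont_def)
  have "(\<lambda>z. deriv f z / (f z / z)) \<midarrow>0\<rightarrow> 1 / 1"
    by (intro tendsto_divide 1 2) auto
  hence "(\<lambda>z. z * deriv f z / f z) \<midarrow>0\<rightarrow> 1"
    by (simp add: mult.commute)
  thus ?thesis unfolding starlike_quot_def by (rule remove_sings_eqI)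
qed

lemma starlike_quot_eq:
  assumes "f holomorphic_on ball 0 1" "z \<in> ball 0 1" "f z \<noteq> 0"
  shows "starlike_quot f z = z * deriv f z / f z"
proof -
  have "f analytic_on {z}"
    using assms(1,2) by (metis analytic_on_analytic_at analytic_on_open open_ball)
  hence "(\<lambda>z. z * deriv f z / f z) analytic_on {z}"
    using assms(3) by (intro analytic_intros) auto
  thus ?thesis by (simp add: starlike_quot_def)
qed

text \<open>The power series form of \<^const>\<open>L_op\<close>.\<close>

lemma L_op_series:
  assumes f: "f \<in> class_A" and c: "c > -1" and z: "z \<in> ball 0 1"
  shows "(\<lambda>k. of_real ((c + 1) / (real (k + 2) + c)) * taylor_coeff f (k + 2) * z ^ (k + 2))
           sums (L_op c f z - z)"
proof (cases "z = 0")
  case True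
  thus ?thesis by (simp add: L_op_def)
next
  case z0: False
  have hol: "f holomorphic_on ball 0 1" and f0: "f 0 = 0" and f1: "deriv f 0 = 1"
    using f by (auto simp: class_A_def)
  define a where "a = (\<lambda>n. taylor_coeff f (Suc n) * z ^ Suc n)"
  have ser: "(\<lambda>n. taylor_coeff f n * w ^ n) sums f w" if "w \<in> ball 0 1" for w
    using holomorphic_power_series[OF hol that] by (simp add: taylor_coeff_def)
  have ser': "(\<lambda>n. taylor_coeff f (Suc n) * w ^ Suc n) sums f w" if "w \<in> ball 0 1" for w
    using ser[OF that] f0 by (subst sums_Suc_iff) (auto simp: taylor_coeff_def)
  have sa: "summable (\<lambda>n. norm (a n))"
  proof -
    obtain r where r: "norm z < r" "r < 1"
      using z dense[of "norm z" 1] by auto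
    have "summable (\<lambda>n. taylor_coeff f n * of_real r ^ n)"
      using ser[of "of_real r"] r norm_ge_zero[of z] by (auto simp: sums_iff)
    hence "summable (\<lambda>n. norm (taylor_coeff f n * z ^ n))"
      using r norm_ge_zero[of z] by (intro powser_insidea[of _ "of_real r"]) auto
    thus ?thesis unfolding a_def by (subst summable_Suc_iff)
  qed
  define g where "g = (\<lambda>s::real. of_real (s powr (c - 1)) * f (of_real s * z))"
  define F where "F = (\<lambda>N (s::real). (\<Sum>n<N. a n * of_real (s powr (c + real n))))"
  define M where "M = (\<Sum>n. norm (a n))"
  have int1: "((\<lambda>s. a n * of_real (s powr (c + real n))) has_integral
                 a n * of_real (1 / (c + real n + 1))) {0..1}" for n
    using has_integral_powr_from_0[of "c + real n" 1] c
    by (intro has_integral_mult_right has_integral_of_real) auto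
  have intF: "(F N has_integral (\<Sum>n<N. a n * of_real (1 / (c + real n + 1)))) {0..1}" for N
    unfolding F_def by (intro has_integral_sum int1) auto
  have bnd: "norm (F N s) \<le> M * s powr c" if s: "s \<in> {0..1}" for N s
  proof -
    have "norm (F N s) \<le> (\<Sum>n<N. norm (a n) * s powr c)"
      unfolding F_def
    proof (rule sum_norm_le)
      fix n
      have "s powr (c + real n) \<le> s powr c"
        using s c by (cases "s = 0") (auto intro!: powr_mono')
      thus "norm (a n * of_real (s powr (c + real n))) \<le> norm (a n) * s powr c"
        by (auto simp: norm_mult intro!: mult_left_mono)
    qed
    also have "\<dots> = (\<Sum>n<N. norm (a n)) * s powr c" by (simp add: sum_distrib_right)
    also have "\<dots> \<le> M * s powr c"
      unfolding M_def by (intro mult_right_mono sum_le_suminf sa) auto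
    finally show ?thesis .
  qed
  have conv: "(\<lambda>N. F N s) \<longlonglongrightarrow> g s" if s: "s \<in> {0..1}" for s
  proof (cases "s = 0")
    case True
    thus ?thesis by (simp add: F_def g_def)
  next
    case False
    with s have s0: "0 < s" by auto
    have "norm (of_real s * z) \<le> norm z"
      using s by (auto simp: norm_mult intro: mult_left_le_one_le)
    hence "of_real s * z \<in> ball 0 1"
      using z by auto
    from sums_mult[OF ser'[OF this], of "of_real (s powr (c - 1))"]
    have "(\<lambda>n. of_real (s powr (c - 1)) *
            (taylor_coeff f (Suc n) * (of_real s * z) ^ Suc n)) sums g s"
      by (simp add: g_def)
    moreover have "of_real (s powr (c - 1)) * (taylor_coeff f (Suc n) * (of_real s * z) ^ Suc n)
           = a n * of_real (s powr (c + real n))" for n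
    proof -
      have "s powr (c + real n) = s powr (c - 1) * s powr real (Suc n)"
        by (simp flip: powr_add)
      also have "s powr real (Suc n) = s ^ Suc n"
        using s0 by (rule powr_realpow)
      finally show ?thesis by (simp add: a_def power_mult_distrib mult_ac)
    qed
    ultimately show ?thesis by (simp add: sums_def F_def)
  qed
  have hint: "(\<lambda>s::real. M * s powr c) integrable_on {0..1}"
    using has_integral_powr_from_0[of c 1] c by (intro integrable_on_mult_right) auto
  have Fint: "F N integrable_on {0..1}" for N
    using intF by blast
  have lim: "(\<lambda>N. integral {0..1} (F N)) \<longlonglongrightarrow> integral {0..1} g"
    by (rule dominated_convergence(2)[OF Fint hint bnd conv])
  hence sums1: "(\<lambda>n. a n * of_real (1 / (c + real n + 1))) sums integral {0..1} g"
    unfolding sums_def integral_unique[OF intF] .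
  have "contour_integral (linepath 0 z) (\<lambda>t. t powr of_real (c - 1) * f t)
      = integral {0..1} (\<lambda>s. z powr of_real c * g s)"
    unfolding contour_integral_integral
  proof (rule integral_cong)
    fix s :: real assume s: "s \<in> {0..1}"
    have "(of_real s * z) powr of_real (c - 1) = of_real s powr of_real (c - 1) * z powr of_real (c - 1)"
      using s by (intro powr_times_real_left) auto
    also have "of_real s powr of_real (c - 1) = (of_real (s powr (c - 1)) :: complex)"
      using s by (subst powr_of_real) auto
    finally have 1: "(of_real s * z) powr of_real (c - 1) =
        of_real (s powr (c - 1)) * z powr of_real (c - 1)" .
    have 2: "z powr of_real (c - 1) * z = z powr of_real c"
      using z0 by (simp add: powr_diff)
    have 3: "linepath 0 z s = of_real s * z"
      by (simp add: linepath_def scaleR_conv_of_real)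
    show "linepath 0 z s powr of_real (c - 1) * f (linepath 0 z s) *
           vector_derivative (linepath 0 z) (at s) = z powr of_real c * g s"
      unfolding g_def vector_derivative_linepath_at 3 1 2[symmetric]
      by (simp add: mult_ac)
  qed
  also have "\<dots> = z powr of_real c * integral {0..1} g"
    by simp
  finally have "L_op c f z = of_real (c + 1) * integral {0..1} g"
    using z0 by (simp add: L_op_def)
  with sums_mult[OF sums1, of "of_real (c + 1)"]
  have S: "(\<lambda>n. of_real (c + 1) * (a n * of_real (1 / (c + real n + 1)))) sums L_op c f z"
    by simp
  have a0: "of_real (c + 1) * (a 0 * of_real (1 / (c + real 0 + 1))) = z"
  proof -
    have "complex_of_real (c + 1) \<noteq> 0" using c by (simp only: of_real_eq_0_iff)
    thus ?thesis using f1 by (simp add: a_def taylor_coeff_def)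
  qed
  have "(\<lambda>n. of_real (c + 1) * (a (Suc n) * of_real (1 / (c + real (Suc n) + 1))))
          sums (L_op c f z - z)"
    using S a0 by (subst sums_Suc_iff) simp
  thus ?thesis by (simp add: a_def field_simps)
qed

end

theory Submission
  imports Defs
begin

text \<open>
  Write \<open>g = I\<^sup>\<sigma> f\<close> and \<open>L\<^sub>c g = z H(z)\<close>. Then \<open>z g' / g - \<lambda> = 1 - \<lambda> + z K' / K\<close> with
  \<open>K = (1 + c) H + z H'\<close>, and the reciprocal of \<open>z (L\<^sub>c g)' / L\<^sub>c g - \<lambda>\<close> is \<open>u = H / N\<close> with
  \<open>N = (1 - \<lambda>) H + z H'\<close>. Unlike the quotient itself, \<open>u\<close> is holomorphic in the whole disc,
  because \<open>N\<close> has no zeros there. A sector of opening at most \<open>\<pi>\<close> is an intersection of two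
  half-planes. If \<open>u\<close> left the open sector, consider a point \<open>z\<^sub>0\<close> of minimal modulus where this happens:
  the first-order conditions at \<open>z\<^sub>0\<close> determine the direction of \<open>z\<^sub>0 u'(z\<^sub>0)\<close>
  (the easy half of Nunokawa's lemma), which forces \<open>z g' / g - \<lambda>\<close> out of its sector at \<open>z\<^sub>0\<close>.
\<close>

section \<open>Sectors as intersections of two half-planes\<close>

text \<open>For \<open>a = cis \<alpha>\<close> with \<open>0 < \<alpha>\<close> and
  \<open>\<alpha> \<le> pi / 2\<close> this is the open sector of half-angle \<open>\<alpha>\<close>
  about the positive real axis. Two linear inequalities allow each edge to be treated by its own
  first-order condition; at \<open>\<alpha> = pi / 2\<close> they coincide.\<close>

definition in_sector :: "complex \<Rightarrow> complex \<Rightarrow> bool" where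
  "in_sector a w \<longleftrightarrow> Im (a * w) > 0 \<and> Im (cnj a * w) < 0"

lemma in_sector_nonzero: "in_sector a w \<Longrightarrow> w \<noteq> 0"
  by (auto simp: in_sector_def)

text \<open>\<open>inverse w\<close> is a positive multiple of \<open>cnj w\<close>, and conjugation
  swaps the two half-planes.\<close>

lemma in_sector_inverse:
  assumes "in_sector a w"
  shows "in_sector a (inverse w)"
proof -
  have w: "(Re w)\<^sup>2 + (Im w)\<^sup>2 > 0"
    using in_sector_nonzero[OF assms] by (simp add: complex_neq_0)
  have 1: "Im (a * inverse w) = - Im (cnj a * w) / ((Re w)\<^sup>2 + (Im w)\<^sup>2)"
   and 2: "Im (cnj a * inverse w) = - Im (a * w) / ((Re w)\<^sup>2 + (Im w)\<^sup>2)"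
    by (simp_all add: add_divide_distrib diff_divide_distrib)
  show ?thesis
    using assms w unfolding in_sector_def 1 2 by (simp add: zero_less_divide_iff divide_less_0_iff)
qed

text \<open>In polar form the two imaginary parts are \<open>norm w\<close> times the sines of
  \<open>\<alpha> + \<theta>\<close> and \<open>\<theta> - \<alpha>\<close>. The origin must be
  excluded because \<open>Arg 0 = 0\<close>.\<close>

lemma in_sector_cis_iff:
  assumes "w \<noteq> 0" "0 < \<alpha>" "\<alpha> \<le> pi / 2"
  shows "in_sector (cis \<alpha>) w \<longleftrightarrow> \<bar>Arg w\<bar> < \<alpha>"
proof -
  define \<theta> where "\<theta> = Arg w"
  have \<theta>: "-pi < \<theta>" "\<theta> \<le> pi"
    using Arg_bounded[of w] by (auto simp: \<theta>_def)
  have w: "w = of_real (norm w) * cis \<theta>"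
    using assms(1) by (simp add: \<theta>_def cis_Arg sgn_eq)
  have "cis \<alpha> * w = of_real (norm w) * cis (\<alpha> + \<theta>)"
    by (subst w) (simp flip: cis_mult)
  hence 1: "Im (cis \<alpha> * w) = norm w * sin (\<alpha> + \<theta>)" by simp
  have "cnj (cis \<alpha>) * w = of_real (norm w) * cis (\<theta> - \<alpha>)"
    by (subst w) (simp add: cis_cnj flip: cis_mult cis_divide cis_inverse, simp add: field_simps)
  hence 2: "Im (cnj (cis \<alpha>) * w) = norm w * sin (\<theta> - \<alpha>)" by simp
  have eq: "in_sector (cis \<alpha>) w \<longleftrightarrow> sin (\<alpha> + \<theta>) > 0 \<and> sin (\<theta> - \<alpha>) < 0"
    using assms(1) unfolding in_sector_def 1 2 by (simp add: zero_less_mult_iff mult_less_0_iff)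
  show ?thesis
  proof
    assume "in_sector (cis \<alpha>) w"
    hence s: "sin (\<alpha> + \<theta>) > 0" "sin (\<theta> - \<alpha>) < 0" by (auto simp: eq)
    have "\<theta> < \<alpha>"
      using s(2) sin_ge_zero[of "\<theta> - \<alpha>"] \<theta> assms by linarith
    moreover have "-\<alpha> < \<theta>"
      using s(1) sin_ge_zero[of "-(\<alpha> + \<theta>)"] \<theta> assms unfolding sin_minus by linarith
    ultimately show "\<bar>Arg w\<bar> < \<alpha>" by (simp add: \<theta>_def abs_less_iff)
  next
    assume "\<bar>Arg w\<bar> < \<alpha>"
    hence "\<theta> < \<alpha>" "-\<alpha> < \<theta>" by (auto simp: \<theta>_def abs_less_iff)
    hence "sin (\<alpha> + \<theta>) > 0" "sin (-(\<theta> - \<alpha>)) > 0"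
      using assms by (intro sin_gt_zero; linarith)+
    thus "in_sector (cis \<alpha>) w" unfolding eq sin_minus by linarith
  qed
qed

section \<open>First-order conditions at a boundary point of a disc\<close>

text \<open>Directions \<open>z0 * v\<close> with \<open>Re v < 0\<close> point into the disc, as
  the squared norm of \<open>1 + s v\<close> is \<open>1 + 2 s Re v\<close> up to second order in
  \<open>s\<close>.\<close>

lemma eventually_norm_perturb_less:
  fixes z0 v :: complex
  assumes "z0 \<noteq> 0" "Re v < 0"
  shows "\<forall>\<^sub>F s in at_right (0::real). norm (z0 * (1 + of_real s * v)) < norm z0"
proof -
  have v: "(norm v)\<^sup>2 > 0" using assms(2) by auto
  have "\<forall>\<^sub>F s in at_right (0::real). s \<in> {0<..<-2 * Re v / (norm v)\<^sup>2}"
    using assms v by (intro eventually_at_right_real) (simp add: divide_neg_pos)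
  thus ?thesis
  proof eventually_elim
    case (elim s)
    hence s: "0 < s" "s * (norm v)\<^sup>2 < -2 * Re v" using v by (auto simp: field_simps)
    have "(norm (1 + of_real s * v))\<^sup>2 = 1 + s * (2 * Re v + s * (norm v)\<^sup>2)"
      by (simp add: cmod_power2) (simp add: power2_eq_square algebra_simps)
    also have "\<dots> < 1" using s by (simp add: mult_pos_neg)
    finally have "norm (1 + of_real s * v) < 1"
      by (simp add: abs_square_less_1)
    thus ?case using assms(1) by (simp add: norm_mult)
  qed
qed

lemma Im_nonneg_at_boundary:
  fixes u :: "complex \<Rightarrow> complex"
  assumes "isCont u z0" "z0 \<noteq> 0" "\<And>z. norm z < norm z0 \<Longrightarrow> Im (u z) > 0"
  shows "Im (u z0) \<ge> 0"
proof -
  have "((\<lambda>s. z0 * (1 + of_real s * (-1))) \<longlongrightarrow> z0 * (1 + of_real 0 * (-1))) (at_right (0::real))"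
    by (intro tendsto_intros)
  hence "((\<lambda>s. Im (u (z0 * (1 + of_real s * (-1))))) \<longlongrightarrow> Im (u z0)) (at_right (0::real))"
    using assms(1) by (intro tendsto_Im isCont_tendsto_compose[of z0 u]) auto
  moreover have "\<forall>\<^sub>F s in at_right (0::real). Im (u (z0 * (1 + of_real s * (-1)))) \<ge> 0"
    by (rule eventually_mono[OF eventually_norm_perturb_less[OF assms(2), of "-1"]])
       (auto intro!: less_imp_le assms(3))
  ultimately show ?thesis
    by (rule tendsto_lowerbound) simp
qed

text \<open>\<open>Im u\<close> cannot decrease when leaving \<open>z0\<close> in an inward
  direction \<open>z0 * v\<close>, so \<open>Im (z0 * u' * v) \<ge> 0\<close> on the whole
  half-plane \<open>Re v < 0\<close>. This confines \<open>z0 * u'\<close> to the nonpositive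
  imaginary axis.\<close>

lemma Im_boundary_derivative:
  assumes u: "(u has_field_derivative u') (at z0)" and z0: "z0 \<noteq> 0"
    and pos: "\<And>z. norm z < norm z0 \<Longrightarrow> Im (u z) > 0" and le: "Im (u z0) \<le> 0"
  shows "Re (z0 * u') = 0" "Im (z0 * u') \<le> 0"
proof -
  have ge: "Im (z0 * u' * v) \<ge> 0" if v: "Re v < 0" for v
  proof (rule ccontr)
    assume neg: "\<not> Im (z0 * u' * v) \<ge> 0"
    define \<phi> where "\<phi> = (\<lambda>s::real. Im (u (z0 * (1 + of_real s * v))))"
    have *: "((\<lambda>s. u (z0 * (1 + s * v))) has_field_derivative u' * (z0 * v)) (at 0)"
      by (rule DERIV_chain2[of u]) (use u in \<open>auto intro!: derivative_eq_intros\<close>)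
    have "((\<lambda>s. u (z0 * (1 + of_real s * v))) has_vector_derivative u' * (z0 * v)) (at (0::real))"
      using has_vector_derivative_real_field[of _ _ 0, simplified, OF *] by simp
    hence "(\<phi> has_field_derivative Im (u' * (z0 * v))) (at 0)"
      unfolding \<phi>_def has_real_derivative_iff_has_vector_derivative
      by (rule bounded_linear.has_vector_derivative[OF bounded_linear_Im])
    moreover have "Im (u' * (z0 * v)) < 0"
      using neg by (simp add: mult_ac)
    ultimately obtain d where d: "d > 0" "\<And>h. 0 < h \<Longrightarrow> h < d \<Longrightarrow> \<phi> (0 + h) < \<phi> 0"
      by (meson DERIV_neg_dec_right)
    have "\<forall>\<^sub>F s in at_right (0::real). s \<in> {0<..<d} \<and> norm (z0 * (1 + of_real s * v)) < norm z0"
      using d(1) by (intro eventually_conj eventually_at_right_real eventually_norm_perturb_less z0 v)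
    then obtain s where s: "0 < s" "s < d" "norm (z0 * (1 + of_real s * v)) < norm z0"
      by (auto dest!: eventually_happens)
    have "\<phi> s < \<phi> 0" using d(2)[of s] s by simp
    moreover have "\<phi> s > 0" unfolding \<phi>_def by (intro pos s)
    ultimately show False using le by (simp add: \<phi>_def)
  qed
  define X where "X = z0 * u'"
  have "Im (z0 * u' * (-1)) \<ge> 0" by (rule ge) simp
  thus "Im (z0 * u') \<le> 0" by simp
  show "Re (z0 * u') = 0"
  proof (rule ccontr)
    assume "Re (z0 * u') \<noteq> 0"
    \<comment> \<open>With \<open>v = Complex (-1) y\<close> the value is
      \<open>y * Re X - Im X\<close>; \<open>y\<close> is chosen to make it
      \<open>-1\<close>.\<close>
    hence "Im (X * Complex (-1) ((Im X - 1) / Re X)) = -1"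
      by (simp add: X_def)
    moreover have "Im (X * Complex (-1) ((Im X - 1) / Re X)) \<ge> 0"
      unfolding X_def by (rule ge) simp
    ultimately show False by simp
  qed
qed

section \<open>Contact of \<open>u = H / N\<close> with an edge of the sector\<close>

text \<open>Here \<open>of_real t * cnj e\<close> stands for the value of \<open>u\<close> at a
  contact point, \<open>X\<close> for \<open>z0 * u'\<close>, and \<open>W\<close> for the value of
  \<open>z g' / g - \<lambda>\<close>. Since \<open>e * X\<close> is purely imaginary, only the real
  part of \<open>cnj e + m t\<close> matters, and it is nonnegative.\<close>

lemma Im_rotated_at_contact:
  fixes e X :: complex and t m :: real
  assumes "norm e = 1" "Re e \<ge> 0" "t > 0" "m \<ge> 0" "Re (e * X) = 0"
    and "W = (1 - X / (1 + of_real (m * t) * cnj e)) / (of_real t * cnj e)"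
  shows "\<exists>\<rho>\<ge>0. Im (cnj e * W) = -\<rho> * Im (e * X)"
proof -
  define B where "B = 1 + of_real (m * t) * e"
  define \<rho> where "\<rho> = (Re e + m * t) / ((norm B)\<^sup>2 * t)"
  have ee: "e * cnj e = 1"
    using assms(1) complex_norm_square[of e] by simp
  have e0: "e \<noteq> 0" using assms(1) by auto
  have "Re B > 0" using assms by (simp add: B_def add_pos_nonneg)
  hence B0: "B \<noteq> 0" by auto
  have cB: "1 + of_real (m * t) * cnj e = cnj B" by (simp add: B_def)
  have X: "e * X = \<i> * of_real (Im (e * X))"
    using assms(5) by (simp add: complex_eq_iff)
  have ie: "1 / cnj e = e" using ee e0 by (simp add: field_simps)
  have "cnj e * W = (1 - X / cnj B) / of_real t"
    unfolding assms(6) cB using e0 by simp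
  also have "\<dots> = 1 / of_real t - (cnj e * B) * (e * X) / of_real ((norm B)\<^sup>2 * t)"
  proof -
    have "of_real ((norm B)\<^sup>2) = B * cnj B" by (rule complex_norm_square)
    moreover have "(cnj e * B) * (e * X) = B * X * (e * cnj e)" by (simp add: mult_ac)
    ultimately show ?thesis
      using B0 assms(3) ee by (simp add: field_simps del: of_real_power)
  qed
  also have "cnj e * B = cnj e + of_real (m * t)"
    using ee by (simp add: B_def algebra_simps)
  also have "Im (1 / of_real t - (cnj e + of_real (m * t)) * (e * X) / of_real ((norm B)\<^sup>2 * t))
      = -\<rho> * Im (e * X)"
    by (subst X, simp only: \<rho>_def) (simp add: Im_divide_of_real algebra_simps add_divide_distrib)
  finally have "Im (cnj e * W) = -\<rho> * Im (e * X)" .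
  moreover have "\<rho> \<ge> 0" using assms by (simp add: \<rho>_def)
  ultimately show ?thesis by blast
qed

text \<open>In terms of \<open>P = N / H\<close>, hypothesis \<open>sect\<close> places the
  Briot-Bouquet expression \<open>P + z P' / (P + m)\<close> with \<open>m = lam + c\<close> in the
  sector, and the claim is that \<open>P\<close> itself lies there.\<close>

lemma in_sector_quotient:
  fixes H :: "complex \<Rightarrow> complex" and lam c :: real
  defines "N \<equiv> \<lambda>z. (1 - of_real lam) * H z + z * deriv H z"
    and "K \<equiv> \<lambda>z. (1 + of_real c) * H z + z * deriv H z"
  assumes hol: "H holomorphic_on ball 0 1" and H0: "H 0 = 1" and lam: "lam < 1" and c: "-lam \<le> c"
    and a: "norm a = 1" "Re a \<ge> 0" "Im a > 0"
    and N: "\<And>z. z \<in> ball 0 1 \<Longrightarrow> N z \<noteq> 0" and K: "\<And>z. z \<in> ball 0 1 \<Longrightarrow> K z \<noteq> 0"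
    and sect: "\<And>z. z \<in> ball 0 1 \<Longrightarrow> in_sector a (1 - of_real lam + z * deriv K z / K z)"
    and z: "z \<in> ball 0 1"
  shows "in_sector a (H z / N z)"
proof (rule ccontr)
  assume bad: "\<not> in_sector a (H z / N z)"
  define u where "u = (\<lambda>z. H z / N z)"
  have holH': "deriv H holomorphic_on ball 0 1"
    using hol by (intro holomorphic_deriv) auto
  have holu: "u holomorphic_on ball 0 1"
    unfolding u_def using N unfolding N_def by (intro holomorphic_intros hol holH') auto
  define B where "B = {w \<in> cball 0 (norm z). Im (a * u w) \<le> 0 \<or> Im (cnj a * u w) \<ge> 0}"
  have sub: "cball 0 (norm z) \<subseteq> ball 0 1" using z by auto
  have contu: "continuous_on (cball 0 (norm z)) u"
    using holu sub by (meson holomorphic_on_imp_continuous_on continuous_on_subset)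
  have "compact B"
  proof -
    have 1: "closed (cball 0 (norm z) \<inter> (\<lambda>w. Im (a * u w)) -` {..0})"
      by (intro continuous_closed_preimage continuous_intros contu) auto
    have 2: "closed (cball 0 (norm z) \<inter> (\<lambda>w. Im (cnj a * u w)) -` {0..})"
      by (intro continuous_closed_preimage continuous_intros contu) auto
    have "B = cball 0 (norm z) \<inter> ((cball 0 (norm z) \<inter> (\<lambda>w. Im (a * u w)) -` {..0}) \<union>
                (cball 0 (norm z) \<inter> (\<lambda>w. Im (cnj a * u w)) -` {0..}))"
      by (auto simp: B_def)
    thus ?thesis using 1 2 by (metis closed_Un compact_Int_closed compact_cball)
  qed
  moreover have "B \<noteq> {}"
    using bad by (auto simp: B_def in_sector_def u_def not_less)
  ultimately obtain z0 where z0: "z0 \<in> B" and min: "\<And>w. w \<in> B \<Longrightarrow> norm z0 \<le> norm w"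
    using continuous_attains_inf[of B norm] continuous_on_norm_id by blast
  have z0le: "norm z0 \<le> norm z" using z0 by (auto simp: B_def)
  hence z0b: "z0 \<in> ball 0 1" using z by auto
  \<comment> \<open>The second inequality is negated so that both have the form required by the
    first-order lemmas.\<close>
  have good: "Im (a * u w) > 0" "Im (- cnj a * u w) > 0" if "norm w < norm z0" for w
    using min[of w] that z0le by (force simp: B_def not_le)+
  have z0nz: "z0 \<noteq> 0"
  proof
    assume "z0 = 0"
    moreover have "u 0 = of_real (1 / (1 - lam))" by (simp add: u_def N_def H0)
    ultimately show False
      using z0 a lam by (auto simp: B_def zero_le_divide_iff divide_le_0_iff
            mult_le_0_iff zero_le_mult_iff)
  qed
  define H1 where "H1 = deriv H z0"
  define H2 where "H2 = deriv (deriv H) z0"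
  have dH [derivative_intros]: "(H has_field_derivative H1) (at z0)"
    unfolding H1_def using hol z0b by (intro holomorphic_derivI[of _ "ball 0 1"]) auto
  have dH1 [derivative_intros]: "(deriv H has_field_derivative H2) (at z0)"
    unfolding H2_def using holH' z0b by (intro holomorphic_derivI[of _ "ball 0 1"]) auto
  define N1 where "N1 = (2 - of_real lam) * H1 + z0 * H2"
  define K1 where "K1 = (2 + of_real c) * H1 + z0 * H2"
  have dN [derivative_intros]: "(N has_field_derivative N1) (at z0)"
    unfolding N_def N1_def
    by (rule derivative_eq_intros dH dH1 refl)+ (simp add: H1_def algebra_simps)
  have dK: "(K has_field_derivative K1) (at z0)"
    unfolding K_def K1_def
    by (rule derivative_eq_intros dH dH1 refl)+ (simp add: H1_def algebra_simps)
  define u1 where "u1 = (H1 * N z0 - H z0 * N1) / (N z0)\<^sup>2"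
  have du: "(u has_field_derivative u1) (at z0)"
    unfolding u_def u1_def using N[OF z0b]
    by (auto intro!: derivative_eq_intros simp: power2_eq_square)
  have dau: "((\<lambda>w. e * u w) has_field_derivative e * u1) (at z0)" for e
    using du by (rule DERIV_cmult)
  have contau: "isCont (\<lambda>w. e * u w) z0" for e
    using dau by (rule DERIV_isCont)
  have ge: "Im (a * u z0) \<ge> 0" "Im (- cnj a * u z0) \<ge> 0"
    by (rule Im_nonneg_at_boundary[OF contau z0nz], erule good)+
  have dir1: "Re (a * (z0 * u1)) = 0" "Im (a * (z0 * u1)) \<le> 0" if "Im (a * u z0) \<le> 0"
    using Im_boundary_derivative[OF dau z0nz good(1) that] by (auto simp: mult_ac)
  have dir2: "Re (cnj a * (z0 * u1)) = 0" "Im (cnj a * (z0 * u1)) \<ge> 0" if "Im (- cnj a * u z0) \<le> 0"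
    using Im_boundary_derivative[OF dau z0nz good(2) that] by (simp_all add: algebra_simps)
  \<comment> \<open>The vertex of the sector: at a zero of \<open>H\<close>,
    \<open>N z0 = z0 * H1\<close>, so \<open>z0 * u1 = 1\<close>. The first-order condition would
    then give \<open>Im a \<le> 0\<close>.\<close>
  have u0: "u z0 \<noteq> 0"
  proof
    assume *: "u z0 = 0"
    hence "H z0 = 0" using N[OF z0b] by (simp add: u_def)
    hence "z0 * u1 = 1" using N[OF z0b] z0nz
      by (auto simp: u1_def N_def H1_def power2_eq_square)
    with dir1(2) * a show False by simp
  qed
  define W where "W = 1 - of_real lam + z0 * deriv K z0 / K z0"
  define m where "m = lam + c"
  have m: "m \<ge> 0" using c by (simp add: m_def)
  \<comment> \<open>Since \<open>K = N + m H\<close>, \<open>1 + m u = K / N\<close>. Comparing its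
    logarithmic derivative with that of \<open>u = H / N\<close> gives the formula, verified here by
    clearing denominators.\<close>
  have W: "W = (1 - z0 * u1 / (1 + of_real m * u z0)) / u z0"
  proof -
    have H0: "H z0 \<noteq> 0" using u0 by (auto simp: u_def)
    have KN: "1 + of_real m * u z0 = K z0 / N z0"
      using N[OF z0b] by (simp add: u_def m_def field_simps) (simp add: K_def N_def algebra_simps)
    have "(1 - z0 * u1 / (1 + of_real m * u z0)) / u z0
           = N z0 / H z0 - z0 * (H1 * N z0 - H z0 * N1) / (K z0 * H z0)"
      unfolding KN using N[OF z0b] K[OF z0b] H0
      by (simp add: u_def u1_def field_simps power2_eq_square)
    also have "\<dots> = W"
    proof -
      have NN: "N z0 = (1 - of_real lam) * H z0 + z0 * H1" by (simp add: N_def H1_def)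
      have KK: "K z0 = (1 + of_real c) * H z0 + z0 * H1" by (simp add: K_def H1_def)
      have "N z0 * K z0 - z0 * (H1 * N z0 - H z0 * N1)
              = ((1 - of_real lam) * K z0 + z0 * K1) * H z0"
        unfolding NN KK N1_def K1_def by (simp add: algebra_simps)
      thus ?thesis
        unfolding W_def DERIV_imp_deriv[OF dK] using K[OF z0b] H0
        by (simp add: divide_simps)
    qed
    finally show ?thesis by simp
  qed
  have sW: "Im (a * W) > 0" "Im (cnj a * W) < 0"
    using sect[OF z0b] by (simp_all add: in_sector_def W_def)
  have aa: "a * cnj a = 1" using a complex_norm_square[of a] by simp
  \<comment> \<open>Contact on the lower edge, the ray through \<open>cnj a\<close>: the sign of
    \<open>Im (a * (z0 * u1))\<close> forces \<open>Im (cnj a * W) \<ge> 0\<close>, against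
    \<open>sW\<close>.\<close>
  have lower: "\<not> (Im (a * u z0) \<le> 0 \<and> Re (a * u z0) > 0)"
  proof
    assume as: "Im (a * u z0) \<le> 0 \<and> Re (a * u z0) > 0"
    define t where "t = Re (a * u z0)"
    have "a * u z0 = of_real t" using as ge by (simp add: t_def complex_eq_iff)
    hence ut: "u z0 = of_real t * cnj a" using aa by (metis mult.assoc mult.commute mult_1)
    have "t > 0" using as by (simp add: t_def)
    moreover have dir: "Re (a * (z0 * u1)) = 0" "Im (a * (z0 * u1)) \<le> 0"
      using as dir1 by blast+
    moreover have "W = (1 - z0 * u1 / (1 + of_real (m * t) * cnj a)) / (of_real t * cnj a)"
      unfolding W ut by (simp add: mult.assoc)
    moreover have "norm a = 1" "Re a \<ge> 0"
      using a by simp_all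
    ultimately obtain \<rho> where "\<rho> \<ge> 0" "Im (cnj a * W) = -\<rho> * Im (a * (z0 * u1))"
      using Im_rotated_at_contact[of a t m "z0 * u1" W] m by blast
    thus False
      using sW dir mult_nonneg_nonpos[of \<rho> "Im (a * (z0 * u1))"] by simp
  qed
  \<comment> \<open>The upper edge is the mirror image, with \<open>e = cnj a\<close>.\<close>
  have upper: "\<not> (Im (- cnj a * u z0) \<le> 0 \<and> Re (cnj a * u z0) > 0)"
  proof
    assume as: "Im (- cnj a * u z0) \<le> 0 \<and> Re (cnj a * u z0) > 0"
    define t where "t = Re (cnj a * u z0)"
    have "cnj a * u z0 = of_real t" using as ge by (simp add: t_def complex_eq_iff)
    hence ut: "u z0 = of_real t * a" using aa by (metis mult.assoc mult.commute mult_1)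
    have "t > 0" using as by (simp add: t_def)
    moreover have dir: "Re (cnj a * (z0 * u1)) = 0" "Im (cnj a * (z0 * u1)) \<ge> 0"
      using as dir2 by blast+
    moreover have "W = (1 - z0 * u1 / (1 + of_real (m * t) * cnj (cnj a))) / (of_real t * cnj (cnj a))"
      unfolding W ut by (simp add: mult.assoc)
    moreover have "norm (cnj a) = 1" "Re (cnj a) \<ge> 0"
      using a by simp_all
    ultimately obtain \<rho> where "\<rho> \<ge> 0" "Im (cnj (cnj a) * W) = -\<rho> * Im (cnj a * (z0 * u1))"
      using Im_rotated_at_contact[of "cnj a" t m "z0 * u1" W] m by blast
    hence "\<rho> * Im (cnj a * (z0 * u1)) < 0" "\<rho> * Im (cnj a * (z0 * u1)) \<ge> 0"
      using sW(1) dir(2) by (simp, intro mult_nonneg_nonneg)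
    thus False by linarith
  qed
  \<comment> \<open>Only plane geometry remains: \<open>u z0\<close> is a nonzero point of the
    closed sector on a bounding line, but both edge rays are excluded. The sign analysis includes
    \<open>p = 0\<close>, where both lines are the imaginary axis.\<close>
  define x y where "x = Re (u z0)" and "y = Im (u z0)"
  define p q where "p = Re a" and "q = Im a"
  have pq: "p \<ge> 0" "q > 0" using a by (auto simp: p_def q_def)
  have xy: "x \<noteq> 0 \<or> y \<noteq> 0" using u0 by (auto simp: x_def y_def complex_eq_iff)
  have A: "p * y + q * x \<ge> 0" and B: "q * x - p * y \<ge> 0"
    using ge by (auto simp: x_def y_def p_def q_def)
  have AB: "p * y + q * x \<le> 0 \<or> q * x - p * y \<le> 0"
    using z0 by (auto simp: B_def x_def y_def p_def q_def)
  have lower': "p * x - q * y \<le> 0" if "p * y + q * x \<le> 0"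
    using lower that by (auto simp: x_def y_def p_def q_def)
  have upper': "p * x + q * y \<le> 0" if "q * x - p * y \<le> 0"
    using upper that by (auto simp: x_def y_def p_def q_def)
  have "q * x \<ge> 0" using A B by linarith
  hence x: "x \<ge> 0" using pq by (simp add: zero_le_mult_iff)
  have "x = 0"
  proof (rule ccontr)
    assume "x \<noteq> 0"
    hence "q * x > 0" "p * x \<ge> 0" using x pq by auto
    show False using AB
    proof
      assume as: "p * y + q * x \<le> 0"
      hence "p * y < 0" using \<open>q * x > 0\<close> by linarith
      hence "q * y < 0" using pq by (simp add: mult_less_0_iff)
      thus False using lower'[OF as] \<open>p * x \<ge> 0\<close> by linarith
    next
      assume as: "q * x - p * y \<le> 0"
      hence "p * y > 0" using \<open>q * x > 0\<close> by linarith
      hence "q * y > 0" using pq by (simp add: zero_less_mult_iff)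
      thus False using upper'[OF as] \<open>p * x \<ge> 0\<close> by linarith
    qed
  qed
  with A B have "p * y = 0" by simp
  hence "q * y \<ge> 0" "q * y \<le> 0" using lower' upper' \<open>x = 0\<close> by auto
  thus False using pq xy \<open>x = 0\<close> by simp
qed

section \<open>The operator \<open>L_op\<close> through power series\<close>

lemma sums_L_op:
  assumes g: "g \<in> class_A" and c: "c > -1" and z: "z \<in> ball 0 1"
  shows "(\<lambda>n. of_real ((c + 1) / (real n + c)) * taylor_coeff g n * z ^ n) sums L_op c g z"
proof -
  define b where "b = (\<lambda>n. of_real ((c + 1) / (real n + c)) * taylor_coeff g n :: complex)"
  have c1: "1 + complex_of_real c \<noteq> 0" using c by (auto simp: complex_eq_iff)
  \<comment> \<open>For \<open>n = 0\<close> the weight is \<open>(c + 1) / c\<close>, which is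
    \<open>0\<close> by convention if \<open>c = 0\<close>; in every case the term vanishes because
    \<open>g 0 = 0\<close>.\<close>
  have "b 0 = 0" "b 1 = 1"
    using g c1 by (auto simp: b_def taylor_coeff_def class_A_def add.commute)
  hence "(\<Sum>n<2. b n * z ^ n) = z"
    by (simp add: eval_nat_numeral)
  hence "(\<lambda>k. b (k + 2) * z ^ (k + 2)) sums (L_op c g z - (\<Sum>n<2. b n * z ^ n))"
    using L_op_series[OF g c z] by (simp add: b_def)
  thus ?thesis
    by (subst (asm) sums_iff_shift') (simp only: b_def)
qed

text \<open>The last identity is the differential equation \<open>(c + 1) g = c F + z F'\<close> of
  \<open>F = L_op c g = z H\<close>. On Taylor coefficients it reads
  \<open>(n + c) b n = (c + 1) a n\<close>.\<close>

lemma L_op_factorization: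
  assumes g: "g \<in> class_A" and c: "c > -1"
  obtains H where "H holomorphic_on ball 0 1" "H 0 = 1"
    "\<And>z. z \<in> ball 0 1 \<Longrightarrow> L_op c g z = z * H z"
    "\<And>z. z \<in> ball 0 1 \<Longrightarrow> (of_real c + 1) * g z = z * ((1 + of_real c) * H z + z * deriv H z)"
proof -
  define b where "b = (\<lambda>n. of_real ((c + 1) / (real n + c)) * taylor_coeff g n :: complex)"
  have holg: "g holomorphic_on ball 0 1"
    using g by (simp add: class_A_def)
  have c1: "1 + complex_of_real c \<noteq> 0" using c by (auto simp: complex_eq_iff)
  have b0: "b 0 = 0" and b1: "b (Suc 0) = 1" and g0: "taylor_coeff g 0 = 0"
    using g c1 by (auto simp: b_def taylor_coeff_def class_A_def add.commute)
  have L: "(\<lambda>n. b n * z ^ n) sums L_op c g z" if "z \<in> ball 0 1" for z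
    using sums_L_op[OF g c that] by (simp add: b_def)
  have SL: "(\<lambda>n. b (Suc n) * z ^ Suc n) sums L_op c g z" if "z \<in> ball 0 1" for z
    using L[OF that] b0 by (subst sums_Suc_iff) simp
  define H where "H = (\<lambda>z. if z = 0 then 1 else L_op c g z / z)"
  have SH: "(\<lambda>n. b (Suc n) * (z - 0) ^ n) sums H z" if "z \<in> ball 0 1" for z
  proof (cases "z = 0")
    case True
    thus ?thesis using powser_sums_zero[of "\<lambda>n. b (Suc n)"] by (simp add: H_def b1)
  next
    case False
    thus ?thesis using sums_divide[OF SL[OF that], of z] by (simp add: H_def)
  qed
  have holH: "H holomorphic_on ball 0 1"
    by (rule power_series_holomorphic) (rule SH)
  have LH: "L_op c g z = z * H z" if "z \<in> ball 0 1" for z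
    by (simp add: H_def L_op_def)
  have eq: "(of_real c + 1) * g z = z * ((1 + of_real c) * H z + z * deriv H z)"
    if z: "z \<in> ball 0 1" for z
  proof -
    have dH: "(H has_field_derivative deriv H z) (at z)"
      using holH z by (intro holomorphic_derivI[of _ "ball 0 1"]) auto
    have "((\<lambda>z. z * H z) has_field_derivative (H z + z * deriv H z)) (at z)"
      by (auto intro!: derivative_eq_intros dH)
    hence "(\<lambda>n. diffs b n * z ^ n) sums (H z + z * deriv H z)"
      using z L LH by (intro termdiffs_sums_strong[of 1 b "\<lambda>z. z * H z"]) auto
    from sums_mult[OF this, of z]
    have "(\<lambda>n. of_nat (Suc n) * b (Suc n) * z ^ Suc n) sums (z * (H z + z * deriv H z))"
      by (simp add: diffs_def mult_ac)
    from sums_add[OF this sums_mult[OF SL[OF z], of "of_real c"]]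
    have "(\<lambda>n. (of_nat (Suc n) + of_real c) * b (Suc n) * z ^ Suc n)
            sums (z * (H z + z * deriv H z) + of_real c * (z * H z))"
      using LH[OF z] by (simp add: algebra_simps)
    moreover have "(of_nat (Suc n) + of_real c) * b (Suc n)
                      = (of_real c + 1) * taylor_coeff g (Suc n)" for n
    proof -
      have "real (Suc n) + c \<noteq> 0" using c by simp
      hence "complex_of_real (real (Suc n) + c) \<noteq> 0" by (simp only: of_real_eq_0_iff not_False_eq_True)
      moreover have "b (Suc n) = (of_real c + 1) / of_real (real (Suc n) + c) * taylor_coeff g (Suc n)"
        by (simp add: b_def)
      ultimately show ?thesis by simp
    qed
    moreover have "(\<lambda>n. (of_real c + 1) * taylor_coeff g (Suc n) * z ^ Suc n) sums ((of_real c + 1) * g z)"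
    proof -
      have "(\<lambda>n. taylor_coeff g n * z ^ n) sums g z"
        using holomorphic_power_series[OF holg z] by (simp add: taylor_coeff_def)
      hence "(\<lambda>n. taylor_coeff g (Suc n) * z ^ Suc n) sums g z"
        using g0 by (subst sums_Suc_iff) simp
      from sums_mult[OF this, of "of_real c + 1"] show ?thesis by (simp add: mult_ac)
    qed
    ultimately have "z * (H z + z * deriv H z) + of_real c * (z * H z) = (of_real c + 1) * g z"
      by (metis (no_types, lifting) sums_unique2 sums_cong)
    thus ?thesis by (simp add: algebra_simps)
  qed
  show thesis
    by (rule that[of H]) (use holH LH eq in \<open>auto simp: H_def\<close>)
qed

section \<open>The quotient \<open>z F' / F\<close> for \<open>F = z H\<close>\<close>

text \<open>Logarithmic differentiation of \<open>z H\<close>, in a form that also covers the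
  removable singularity at the origin.\<close>

lemma starlike_quot_mult_id:
  assumes F: "F \<in> class_A" and H: "H holomorphic_on ball 0 1" "H 0 = 1"
    and eq: "\<And>z. z \<in> ball 0 1 \<Longrightarrow> F z = z * H z"
    and z: "z \<in> ball 0 1" "H z \<noteq> 0"
  shows "starlike_quot F z = 1 + z * deriv H z / H z"
proof (cases "z = 0")
  case True
  thus ?thesis using starlike_quot_0[OF F] by simp
next
  case False
  have "(H has_field_derivative deriv H z) (at z)"
    using H z by (intro holomorphic_derivI[of _ "ball 0 1"]) auto
  hence "((\<lambda>z. z * H z) has_field_derivative (H z + z * deriv H z)) (at z)"
    by (auto intro!: derivative_eq_intros)
  hence "(F has_field_derivative (H z + z * deriv H z)) (at z)"
    by (rule has_field_derivative_transform_within_open[of _ _ _ "ball 0 1"]) (use z eq in auto)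
  hence "deriv F z = H z + z * deriv H z" by (rule DERIV_imp_deriv)
  moreover have "starlike_quot F z = z * deriv F z / F z"
    using F z False eq by (intro starlike_quot_eq) (auto simp: class_A_def)
  ultimately show ?thesis
    using eq[OF z(1)] z(2) False by (simp add: add_divide_distrib)
qed

lemma mult_id_in_class_A:
  assumes H: "H holomorphic_on ball 0 1" "H 0 = 1" and eq: "\<And>z. z \<in> ball 0 1 \<Longrightarrow> F z = z * H z"
  shows "F \<in> class_A"
proof -
  have "(\<lambda>z. z * H z) holomorphic_on ball 0 1"
    by (intro holomorphic_intros H)
  hence hol: "F holomorphic_on ball 0 1"
    using eq by (subst holomorphic_cong[OF refl]) auto
  have "(H has_field_derivative deriv H 0) (at 0)"
    using H by (intro holomorphic_derivI[of _ "ball 0 1"]) auto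
  hence "((\<lambda>z. z * H z) has_field_derivative 1) (at 0)"
    using H(2) by (auto intro!: derivative_eq_intros)
  hence "(F has_field_derivative 1) (at 0)"
    by (rule has_field_derivative_transform_within_open[of _ _ _ "ball 0 1"]) (use eq in auto)
  thus ?thesis using hol eq[of 0] by (auto simp: class_A_def DERIV_imp_deriv)
qed

theorem theorem2p12:
  fixes lam c \<eta> \<sigma> :: real and f :: "complex \<Rightarrow> complex"
  assumes "0 \<le> lam" and "lam < 1"
    and "c > -1" and "-lam \<le> c"
    and "0 < \<eta>" and "\<eta> \<le> 1"
    and "f \<in> class_A"
    and "quot_omits (L_op c (I_op \<sigma> f)) lam"
    and "f \<in> ST_I \<sigma> \<eta> lam"
  shows "I_op \<sigma> f \<in> ST_L c \<eta> lam"
proof -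
  define g F where "g = I_op \<sigma> f" and "F = L_op c g"
  define \<alpha> where "\<alpha> = pi / 2 * \<eta>"
  have \<alpha>: "0 < \<alpha>" "\<alpha> \<le> pi / 2"
    using assms(5,6) by (auto simp: \<alpha>_def)
  have g: "g \<in> class_A" and g_arg: "\<And>z. z \<in> ball 0 1 \<Longrightarrow> \<bar>Arg (starlike_quot g z - of_real lam)\<bar> < \<alpha>"
    and g_fin: "\<And>z. z \<in> ball 0 1 \<Longrightarrow> quot_finite g z"
    and g_omits: "\<And>z. z \<in> ball 0 1 \<Longrightarrow> starlike_quot g z \<noteq> of_real lam"
    using assms(9) by (auto simp: ST_I_def strongly_starlike_def g_def \<alpha>_def quot_omits_def)
  obtain H where H: "H holomorphic_on ball 0 1" "H 0 = 1"
    and FH: "\<And>z. z \<in> ball 0 1 \<Longrightarrow> F z = z * H z"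
    and gH: "\<And>z. z \<in> ball 0 1 \<Longrightarrow> (of_real c + 1) * g z = z * ((1 + of_real c) * H z + z * deriv H z)"
    using L_op_factorization[OF g assms(3)] unfolding F_def by metis
  have F: "F \<in> class_A"
    using H FH by (rule mult_id_in_class_A)
  define N where "N = (\<lambda>z. (1 - of_real lam) * H z + z * deriv H z)"
  define K where "K = (\<lambda>z. (1 + of_real c) * H z + z * deriv H z)"
  have c1: "complex_of_real c + 1 \<noteq> 0" "1 + complex_of_real c \<noteq> 0"
    using assms(3) by (auto simp: complex_eq_iff)
  have holK: "K holomorphic_on ball 0 1"
    unfolding K_def by (intro holomorphic_intros H holomorphic_deriv) auto
  have K0: "K 0 = of_real c + 1" by (simp add: K_def H)
  \<comment> \<open>As \<open>(c + 1) g = z K\<close>, a zero of \<open>K\<close> off the origin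
    would be a zero of \<open>g\<close>, excluded by \<open>g_fin\<close>.\<close>
  have K: "K z \<noteq> 0" if z: "z \<in> ball 0 1" for z
    using gH[OF z] g_fin[OF z] c1 K0 by (auto simp: quot_finite_def K_def)
  \<comment> \<open>Where \<open>H\<close> is nonzero, \<open>N / H\<close> is the quotient of
    \<open>F\<close> minus \<open>lam\<close>, nonzero by \<open>quot_omits\<close>. That hypothesis
    is silent at zeros of \<open>H\<close>, but there \<open>N\<close> and \<open>K\<close>
    coincide.\<close>
  have N: "N z \<noteq> 0" if z: "z \<in> ball 0 1" for z
  proof (cases "H z = 0")
    case True
    thus ?thesis using K[OF z] by (simp add: N_def K_def)
  next
    case False
    have "starlike_quot F z \<noteq> of_real lam"
      using assms(8) z False FH[OF z] unfolding quot_omits_def F_def[symmetric] g_def[symmetric]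
      by (cases "z = 0") (auto simp: quot_finite_def)
    hence "1 + z * deriv H z / H z \<noteq> of_real lam"
      using starlike_quot_mult_id[OF F H FH z False] by simp
    thus ?thesis using False by (auto simp: N_def field_simps)
  qed
  have quot_g: "starlike_quot g z = 1 + z * deriv K z / K z" if z: "z \<in> ball 0 1" for z
  proof -
    \<comment> \<open>Dividing by \<open>c + 1\<close> gives \<open>g = z G\<close> with
      \<open>G 0 = 1\<close>; the constant cancels in the quotient.\<close>
    define G where "G = (\<lambda>z. K z / (of_real c + 1))"
    have holG: "G holomorphic_on ball 0 1" and G0: "G 0 = 1"
      unfolding G_def by (intro holomorphic_intros holK) (use c1 K0 in auto)
    have "deriv G z = deriv K z / (of_real c + 1)"
      unfolding G_def using holK z
      by (intro deriv_cdivide_right) (auto simp: holomorphic_on_open field_differentiable_def)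
    moreover have "starlike_quot g z = 1 + z * deriv G z / G z"
    proof (rule starlike_quot_mult_id[OF g holG G0 _ z])
      show "g w = w * G w" if "w \<in> ball 0 1" for w
        using gH[OF that] c1 by (simp add: G_def K_def field_simps)
      show "G z \<noteq> 0" using K[OF z] c1 by (simp add: G_def)
    qed
    ultimately show ?thesis using c1 by (simp add: G_def)
  qed
  have sect: "in_sector (cis \<alpha>) (1 - of_real lam + z * deriv K z / K z)" if z: "z \<in> ball 0 1" for z
    using g_arg[OF z] g_omits[OF z] \<alpha> in_sector_cis_iff[of "starlike_quot g z - of_real lam" \<alpha>]
    by (simp add: quot_g[OF z] algebra_simps)
  have HN: "in_sector (cis \<alpha>) (H z / N z)" if z: "z \<in> ball 0 1" for z
    unfolding N_def
  proof (rule in_sector_quotient[OF H assms(2,4)])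
    show "Re (cis \<alpha>) \<ge> 0" "Im (cis \<alpha>) > 0"
      using \<alpha> by (auto intro!: cos_ge_zero sin_gt_zero)
  qed (use N K sect z in \<open>auto simp: N_def K_def\<close>)
  have "quot_finite F z \<and> \<bar>Arg (starlike_quot F z - of_real lam)\<bar> < \<alpha>" if z: "z \<in> ball 0 1" for z
  proof
    \<comment> \<open>The sector omits \<open>0\<close>, so \<open>H\<close> has no zeros: this is
      where poles of the quotient of \<open>F\<close> are ruled out.\<close>
    have Hz: "H z \<noteq> 0" using in_sector_nonzero[OF HN[OF z]] by auto
    thus "quot_finite F z" by (simp add: quot_finite_def FH[OF z])
    have "starlike_quot F z - of_real lam = inverse (H z / N z)"
      using starlike_quot_mult_id[OF F H FH z Hz] Hz by (simp add: N_def field_simps)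
    hence "in_sector (cis \<alpha>) (starlike_quot F z - of_real lam)"
      using in_sector_inverse[OF HN[OF z]] by simp
    thus "\<bar>Arg (starlike_quot F z - of_real lam)\<bar> < \<alpha>"
      using in_sector_cis_iff[OF in_sector_nonzero \<alpha>] by blast
  qed
  thus ?thesis
    using F g assms(8) unfolding ST_L_def strongly_starlike_def \<alpha>_def by (simp add: F_def g_def)
qed

end
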